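(* Let $G$ be a simple undirected graph on vertices $\{1,\dots,n\}$ and let $A_G$ be its adjacency matrix. Then $\mathrm{Aut}(G)$, regarded as a group of permutation matrices, is the set of matrices $P=[P_{i,j}]_{i,j=1}^n$ given by the zeroes in $\mathbb{R}^{n\times n}$ of the ideal $I_G\subseteq\mathbb{R}[P_{i,j}:1\le i,j\le n]$ generated from the equations $$(PA_G-A_GP)_{i,j}=0,\ \ 1\le i,j\le n;\qquad \sum_{i=1}^nP_{i,j}=1,\ \ 1\le j\le n;$$ $$\sum_{j=1}^nP_{i,j}=1,\ \ 1\le i\le n;\qquad P_{i,j}^2-P_{i,j}=0,\ \ 1\le i,j\le n.$$
   Context: $\mathrm{Aut}(G)$ is the group of permutations of the vertices of $G$ that preserve edge adjacency, each permutation being identified with its $n\times n$ permutation matrix. *)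

theory Defs
  imports
    "HOL-Analysis.Analysis"
    "HOL-Algebra.Ideal"
    "HOL-Decision_Procs.Algebra_Aux"
    "HOL-Library.Poly_Mapping"
begin

text \<open>
  The vertex set is a finite type \<open>'n\<close>, so \<open>n = CARD('n)\<close>. A simple undirected graph is a
  symmetric, irreflexive relation \<open>E\<close> on \<open>'n\<close>.
\<close>

definition simple_graph :: "('n \<Rightarrow> 'n \<Rightarrow> bool) \<Rightarrow> bool" where
  "simple_graph E \<longleftrightarrow> symp E \<and> irreflp E"

definition adjacency_matrix :: "('n::finite \<Rightarrow> 'n \<Rightarrow> bool) \<Rightarrow> real ^ 'n ^ 'n" where
  "adjacency_matrix E = (\<chi> i j. if E i j then 1 else 0)"

definition aut_group :: "('n \<Rightarrow> 'n \<Rightarrow> bool) \<Rightarrow> ('n \<Rightarrow> 'n) monoid" where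
  "aut_group E =
     \<lparr>carrier = {\<sigma>. bij \<sigma> \<and> (\<forall>i j. E (\<sigma> i) (\<sigma> j) \<longleftrightarrow> E i j)}, mult = (\<circ>), one = id\<rparr>"

text \<open>
  The convention is that the matrix of \<open>\<sigma>\<close> sends the basis vector \<open>e\<^sub>j\<close> to \<open>e\<^bsub>\<sigma> j\<^esub>\<close>, so that
  \<open>\<sigma> \<mapsto> perm_matrix \<sigma>\<close> is multiplicative.
\<close>

definition perm_matrix :: "('n::finite \<Rightarrow> 'n) \<Rightarrow> real ^ 'n ^ 'n" where
  "perm_matrix \<sigma> = (\<chi> i j. if i = \<sigma> j then 1 else 0)"

lemma group_aut_group: "group (aut_group E)"
proof (rule groupI)
  fix \<sigma> assume "\<sigma> \<in> carrier (aut_group E)"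
  then have b: "bij \<sigma>" and e: "E (\<sigma> i) (\<sigma> j) \<longleftrightarrow> E i j" for i j
    by (auto simp: aut_group_def)
  have "E (inv_into UNIV \<sigma> i) (inv_into UNIV \<sigma> j) \<longleftrightarrow> E i j" for i j
    using e[of "inv_into UNIV \<sigma> i" "inv_into UNIV \<sigma> j"] b by (simp add: bij_is_surj surj_f_inv_f)
  moreover have "inv_into UNIV \<sigma> \<circ> \<sigma> = id"
    using b by (simp add: bij_is_inj)
  ultimately show "\<exists>\<tau>\<in>carrier (aut_group E). \<tau> \<otimes>\<^bsub>aut_group E\<^esub> \<sigma> = \<one>\<^bsub>aut_group E\<^esub>"
    using b by (intro bexI[of _ "inv_into UNIV \<sigma>"]) (auto simp: aut_group_def bij_imp_bij_inv)
qed (auto simp: aut_group_def bij_comp comp_assoc)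

lemma perm_matrix_comp: "perm_matrix (\<sigma> \<circ> \<tau>) = perm_matrix \<sigma> ** perm_matrix \<tau>"
proof -
  have "(\<Sum>k\<in>UNIV. (if i = \<sigma> k then 1 else 0) * (if k = \<tau> j then 1 else 0))
      = (\<Sum>k\<in>UNIV. if k = \<tau> j then (if i = \<sigma> k then 1 else 0) else (0::real))" for i j
    by (rule sum.cong) auto
  then show ?thesis
    by (simp add: perm_matrix_def matrix_matrix_mult_def vec_eq_iff)
qed

lemma perm_matrix_id: "perm_matrix id = mat 1"
  by (simp add: perm_matrix_def mat_def)

lemma inj_perm_matrix: "inj perm_matrix"
proof (rule injI, rule ext)
  fix \<sigma> \<tau> :: "'n::finite \<Rightarrow> 'n" and j
  assume "perm_matrix \<sigma> = perm_matrix \<tau>"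
  then have "perm_matrix \<sigma> $ \<sigma> j $ j = perm_matrix \<tau> $ \<sigma> j $ j" by simp
  then show "\<sigma> j = \<tau> j" by (simp add: perm_matrix_def split: if_splits)
qed

text \<open>
  Real polynomials in finitely many variables indexed by \<open>'v\<close>: finitely supported maps from
  exponent vectors \<open>'v \<Rightarrow>\<^sub>0 nat\<close> to coefficients, with the convolution product.
\<close>

type_synonym 'v real_mpoly = "('v \<Rightarrow>\<^sub>0 nat) \<Rightarrow>\<^sub>0 real"

definition Var :: "'v \<Rightarrow> 'v real_mpoly" where
  "Var v = Poly_Mapping.single (Poly_Mapping.single v 1) 1"

definition Const :: "real \<Rightarrow> 'v real_mpoly" where
  "Const c = Poly_Mapping.single 0 c"

definition eval_mpoly :: "('v::finite \<Rightarrow> real) \<Rightarrow> 'v real_mpoly \<Rightarrow> real" where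
  "eval_mpoly x p =
     (\<Sum>m\<in>Poly_Mapping.keys p.
        Poly_Mapping.lookup p m * (\<Prod>v\<in>UNIV. x v ^ Poly_Mapping.lookup m v))"

lemma eval_mpoly_Const: "eval_mpoly x (Const c) = c"
  by (simp add: eval_mpoly_def Const_def)

lemma eval_mpoly_Var: "eval_mpoly x (Var v) = x v"
  by (simp add: eval_mpoly_def Var_def lookup_single when_def if_distrib[of "power _"] cong: if_cong)

definition generic_matrix :: "(('n \<times> 'n) real_mpoly) ^ 'n ^ 'n" where
  "generic_matrix = (\<chi> i j. Var (i, j))"

definition const_matrix :: "real ^ 'n ^ 'n \<Rightarrow> (('n \<times> 'n) real_mpoly) ^ 'n ^ 'n" where
  "const_matrix A = (\<chi> i j. Const (A $ i $ j))"

definition aut_generators :: "('n::finite \<Rightarrow> 'n \<Rightarrow> bool) \<Rightarrow> ('n \<times> 'n) real_mpoly set" where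
  "aut_generators E =
     (let P = generic_matrix; A = const_matrix (adjacency_matrix E) in
        {(P ** A - A ** P) $ i $ j | i j. True}
      \<union> {(\<Sum>i\<in>UNIV. P $ i $ j) - 1 | j. True}
      \<union> {(\<Sum>j\<in>UNIV. P $ i $ j) - 1 | i. True}
      \<union> {(P $ i $ j)\<^sup>2 - P $ i $ j | i j. True})"

text \<open>
  \<^const>\<open>cring_class_ops\<close> is the polynomial ring as a ring record; \<open>Idl\<close> is the ideal generated
  by a set in that ring.
\<close>

definition aut_ideal :: "('n::finite \<Rightarrow> 'n \<Rightarrow> bool) \<Rightarrow> ('n \<times> 'n) real_mpoly set" where
  "aut_ideal E = Idl\<^bsub>cring_class_ops\<^esub> (aut_generators E)"

definition zero_set :: "('n::finite \<times> 'n) real_mpoly set \<Rightarrow> (real ^ 'n ^ 'n) set" where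
  "zero_set I = {P. \<forall>p\<in>I. eval_mpoly (\<lambda>(i, j). P $ i $ j) p = 0}"

end

theory Submission
  imports Defs
begin

text \<open>
  Evaluation at a point is a ring homomorphism, so its kernel is an ideal, and an ideal has the same
  zeros as any set of its generators. At a zero the equations \<open>x\<^sup>2 = x\<close> make every entry 0 or 1;
  the row and column sums then force exactly one 1 in each row and column, and such a matrix commutes
  with the adjacency matrix exactly when its permutation preserves adjacency.
\<close>

text \<open>Outside \<open>keys p\<close> the coefficient is 0, so enlarging the index set only adds
  zero terms. This lets \<open>p\<close>, \<open>q\<close> and \<open>p + q\<close>, whose supports
  may differ by cancellation, be summed over one common set.\<close>

lemma eval_mpoly_superset:
  assumes "finite K" "Poly_Mapping.keys p \<subseteq> K"
  shows "eval_mpoly x p =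
    (\<Sum>m\<in>K. Poly_Mapping.lookup p m * (\<Prod>v\<in>UNIV. x v ^ Poly_Mapping.lookup m v))"
  unfolding eval_mpoly_def
  by (rule sum.mono_neutral_left) (use assms in \<open>auto simp: in_keys_iff\<close>)

lemma eval_mpoly_0: "eval_mpoly x 0 = 0"
  by (simp add: eval_mpoly_def)

lemma eval_mpoly_1: "eval_mpoly x 1 = 1"
  by (simp add: eval_mpoly_def)

lemma eval_mpoly_add: "eval_mpoly x (p + q) = eval_mpoly x p + eval_mpoly x q"
proof -
  let ?K = "Poly_Mapping.keys p \<union> Poly_Mapping.keys q"
  have "finite ?K" "Poly_Mapping.keys (p + q) \<subseteq> ?K"
    by (simp_all add: Poly_Mapping.keys_add)
  then show ?thesis
    by (simp add: eval_mpoly_superset[of ?K] lookup_add algebra_simps sum.distrib)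
qed

lemma eval_mpoly_uminus: "eval_mpoly x (- p) = - eval_mpoly x p"
  using eval_mpoly_add[of x p "- p"] by (simp add: eval_mpoly_0)

lemma eval_mpoly_diff: "eval_mpoly x (p - q) = eval_mpoly x p - eval_mpoly x q"
  using eval_mpoly_add[of x p "- q"] by (simp add: eval_mpoly_uminus)

lemma eval_mpoly_sum: "eval_mpoly x (\<Sum>i\<in>I. f i) = (\<Sum>i\<in>I. eval_mpoly x (f i))"
  by (induction I rule: infinite_finite_induct) (simp_all add: eval_mpoly_0 eval_mpoly_add)

lemma eval_mpoly_single:
  "eval_mpoly x (Poly_Mapping.single m c) = c * (\<Prod>v\<in>UNIV. x v ^ Poly_Mapping.lookup m v)"
  by (simp add: eval_mpoly_def)

lemma sum_single_lookup:
  "(\<Sum>m\<in>Poly_Mapping.keys p. Poly_Mapping.single m (Poly_Mapping.lookup p m)) = p"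
  by (rule poly_mapping_eqI)
    (simp add: lookup_sum lookup_single when_def in_keys_iff)

text \<open>Both sides are biadditive, so splitting \<open>p\<close> and \<open>q\<close> into
  monomials reduces the claim to a product of two monomials, where exponents add and powers
  multiply.\<close>

lemma eval_mpoly_mult: "eval_mpoly x (p * q) = eval_mpoly x p * eval_mpoly x q"
proof -
  let ?s = "\<lambda>p m. Poly_Mapping.single m (Poly_Mapping.lookup p m)"
  have single: "eval_mpoly x (?s p m * ?s q n) = eval_mpoly x (?s p m) * eval_mpoly x (?s q n)" for m n
    by (simp add: mult_single eval_mpoly_single lookup_add power_add prod.distrib)
  have "eval_mpoly x (p * q) =
      eval_mpoly x ((\<Sum>m\<in>Poly_Mapping.keys p. ?s p m) * (\<Sum>n\<in>Poly_Mapping.keys q. ?s q n))"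
    by (simp only: sum_single_lookup)
  also have "\<dots> = eval_mpoly x (\<Sum>m\<in>Poly_Mapping.keys p. ?s p m) *
      eval_mpoly x (\<Sum>n\<in>Poly_Mapping.keys q. ?s q n)"
    by (simp only: sum_product eval_mpoly_sum single)
  finally show ?thesis
    by (simp only: sum_single_lookup)
qed

lemma ideal_eval_mpoly_kernel:
  fixes x :: "'v::finite \<Rightarrow> real"
  shows "ideal {p. eval_mpoly x p = 0} cring_class_ops"
proof (rule idealI)
  show "ring (cring_class_ops :: 'v real_mpoly ring)"
    by (rule cring.axioms(1)) (rule cring_class)
  show "subgroup {p. eval_mpoly x p = 0} (add_monoid cring_class_ops)"
  proof (rule group.subgroupI)
    show "group (add_monoid (cring_class_ops :: 'v real_mpoly ring))"
      using cring_class cring.axioms(1) ring.is_abelian_group abelian_group.a_group by blast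
    \<comment> \<open>The inverse in the additive monoid of the record is the type class negation,
      by \<open>uminus_class\<close>.\<close>
    have "eval_mpoly x (inv\<^bsub>add_monoid cring_class_ops\<^esub> p) = - eval_mpoly x p" for p
      using uminus_class[of p] by (simp add: a_inv_def eval_mpoly_uminus)
    then show "\<And>p. p \<in> {p. eval_mpoly x p = 0} \<Longrightarrow>
        inv\<^bsub>add_monoid cring_class_ops\<^esub> p \<in> {p. eval_mpoly x p = 0}"
      by simp
  qed (auto simp: cring_class_ops_def eval_mpoly_add intro: eval_mpoly_0)
qed (auto simp: cring_class_ops_def eval_mpoly_mult)

lemma zero_set_genideal:
  fixes S :: "('n::finite \<times> 'n) real_mpoly set"
  shows "zero_set (Idl\<^bsub>cring_class_ops\<^esub> S) = zero_set S"
proof -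
  have ring: "ring (cring_class_ops :: ('n \<times> 'n) real_mpoly ring)"
    by (rule cring.axioms(1)) (rule cring_class)
  have "S \<subseteq> Idl\<^bsub>cring_class_ops\<^esub> S"
    by (rule ring.genideal_self[OF ring]) (simp add: cring_class_ops_def)
  moreover have "Idl\<^bsub>cring_class_ops\<^esub> S \<subseteq> {p. eval_mpoly x p = 0}"
    if "S \<subseteq> {p. eval_mpoly x p = 0}" for x
    by (rule ring.genideal_minimal[OF ring ideal_eval_mpoly_kernel that])
  ultimately show ?thesis
    unfolding zero_set_def by blast
qed

lemma zero_set_aut_generators:
  fixes E :: "'n::finite \<Rightarrow> 'n \<Rightarrow> bool"
  shows "P \<in> zero_set (aut_generators E) \<longleftrightarrow>
    P ** adjacency_matrix E = adjacency_matrix E ** P \<and>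
    (\<forall>j. (\<Sum>i\<in>UNIV. P $ i $ j) = 1) \<and> (\<forall>i. (\<Sum>j\<in>UNIV. P $ i $ j) = 1) \<and>
    (\<forall>i j. (P $ i $ j)\<^sup>2 = P $ i $ j)"
proof -
  \<comment> \<open>Quantifying over indices instead of over the set of generators lets the
    simplifier evaluate each family of equations entry by entry.\<close>
  have ball1: "(\<forall>p\<in>{f i | i. True}. Q p) \<longleftrightarrow> (\<forall>i. Q (f i))"
    and ball2: "(\<forall>p\<in>{g i j | i j. True}. Q p) \<longleftrightarrow> (\<forall>i j. Q (g i j))"
    for f :: "'n \<Rightarrow> ('n \<times> 'n) real_mpoly" and g :: "'n \<Rightarrow> 'n \<Rightarrow> ('n \<times> 'n) real_mpoly" and Q
    by blast+
  show ?thesis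
    unfolding zero_set_def aut_generators_def Let_def mem_Collect_eq ball_Un ball1 ball2
    by (simp add: generic_matrix_def const_matrix_def matrix_matrix_mult_def vec_eq_iff
        eval_mpoly_diff eval_mpoly_sum eval_mpoly_mult eval_mpoly_1 eval_mpoly_Var
        eval_mpoly_Const power2_eq_square)
qed

text \<open>A real idempotent is 0 or 1, so the sum counts the indices with value 1.\<close>

lemma sum_idempotent_eq_1D:
  fixes f :: "'a \<Rightarrow> real"
  assumes "finite A" "\<And>i. i \<in> A \<Longrightarrow> (f i)\<^sup>2 = f i" "sum f A = 1"
  shows "\<exists>!i. i \<in> A \<and> f i = 1"
proof -
  have f: "f i = (if f i = 1 then 1 else 0)" if "i \<in> A" for i
    using assms(2)[OF that] by (auto simp: power2_eq_square)
  have "sum f A = (\<Sum>i\<in>A. if f i = 1 then 1 else 0)"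
    by (rule sum.cong) (use f in auto)
  also have "\<dots> = real (card {i \<in> A. f i = 1})"
    using assms(1) by (simp add: sum.If_cases Int_def)
  finally have "card {i \<in> A. f i = 1} = 1"
    using assms(3) by simp
  then show ?thesis
    by (simp add: card_1_singleton_iff set_eq_iff) metis
qed

text \<open>Separates off the equations that do not mention the graph: they alone cut out all
  permutation matrices.\<close>

lemma perm_matrix_iff:
  "P \<in> perm_matrix ` {\<sigma>. bij \<sigma>} \<longleftrightarrow>
    (\<forall>j. (\<Sum>i\<in>UNIV. P $ i $ j) = 1) \<and> (\<forall>i. (\<Sum>j\<in>UNIV. P $ i $ j) = 1) \<and>
    (\<forall>i j. (P $ i $ j)\<^sup>2 = P $ i $ j)"
  (is "_ \<longleftrightarrow> ?R")
proof
  assume "P \<in> perm_matrix ` {\<sigma>. bij \<sigma>}"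
  then obtain \<sigma> where \<sigma>: "bij \<sigma>" and P: "P = perm_matrix \<sigma>"
    by blast
  \<comment> \<open>Reindexing along \<sigma> turns the row sum into a sum over k = \<sigma> j with
    the single nonzero term k = i.\<close>
  have "(\<Sum>j\<in>UNIV. if i = \<sigma> j then 1 else (0::real)) = 1" for i
    using sum.reindex_bij_betw[OF \<sigma>, of "\<lambda>k. if i = k then 1 else (0::real)"] by simp
  then show ?R
    by (simp add: P perm_matrix_def)
next
  assume ?R
  then have idem: "(P $ i $ j)\<^sup>2 = P $ i $ j"
    and ex_row: "\<exists>!i. P $ i $ j = 1" and ex_col: "\<exists>!j. P $ i $ j = 1" for i j
    using sum_idempotent_eq_1D[of UNIV "\<lambda>i. P $ i $ j"]
      sum_idempotent_eq_1D[of UNIV "\<lambda>j. P $ i $ j"]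
    by auto
  \<comment> \<open>The permutation is read off the columns: \<sigma> j is the row of the only 1 in
    column j.\<close>
  have "\<forall>j. \<exists>k. \<forall>i. P $ i $ j = 1 \<longleftrightarrow> i = k"
    using ex_row by blast
  then obtain \<sigma> where \<sigma>: "\<And>i j. P $ i $ j = 1 \<longleftrightarrow> i = \<sigma> j"
    by (auto dest: choice)
  have "bij \<sigma>"
    \<comment> \<open>In terms of \<sigma>, a unique 1 in row i says that i has exactly one
      preimage.\<close>
    using ex_col unfolding \<sigma> bij_iff by metis
  moreover have "P $ i $ j = 0" if "i \<noteq> \<sigma> j" for i j
    using idem[of i j] \<sigma>[of i j] that by (auto simp: power2_eq_square)
  then have "P = perm_matrix \<sigma>"
    using \<sigma> by (simp add: perm_matrix_def vec_eq_iff)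
  ultimately show "P \<in> perm_matrix ` {\<sigma>. bij \<sigma>}"
    by blast
qed

text \<open>Naming the row as \<sigma> k avoids the inverse permutation: by injectivity only the
  summand at k survives.\<close>

lemma perm_matrix_mult_nth:
  fixes A :: "real ^ 'n ^ 'n::finite"
  assumes "inj \<sigma>"
  shows "(perm_matrix \<sigma> ** A) $ \<sigma> k $ j = A $ k $ j"
  using assms by (simp add: perm_matrix_def matrix_matrix_mult_def inj_eq
      if_distrib[of "\<lambda>x. x * _"] cong: if_cong)

lemma mult_perm_matrix_nth:
  fixes A :: "real ^ 'n ^ 'n::finite"
  shows "(A ** perm_matrix \<sigma>) $ i $ j = A $ i $ \<sigma> j"
  by (simp add: perm_matrix_def matrix_matrix_mult_def if_distrib[of "(*) _"] cong: if_cong)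

lemma perm_matrix_commutes_iff:
  assumes "bij \<sigma>"
  shows "perm_matrix \<sigma> ** adjacency_matrix E = adjacency_matrix E ** perm_matrix \<sigma> \<longleftrightarrow>
    (\<forall>i j. E (\<sigma> i) (\<sigma> j) \<longleftrightarrow> E i j)"
proof -
  \<comment> \<open>By surjectivity every row has the form \<sigma> i, so it suffices to compare
    entries (\<sigma> i, j); there the two products are the adjacency entries at (i, j) and
    (\<sigma> i, \<sigma> j).\<close>
  have "perm_matrix \<sigma> ** adjacency_matrix E = adjacency_matrix E ** perm_matrix \<sigma> \<longleftrightarrow>
      (\<forall>i j. (perm_matrix \<sigma> ** adjacency_matrix E) $ \<sigma> i $ j =
        (adjacency_matrix E ** perm_matrix \<sigma>) $ \<sigma> i $ j)"
    using bij_is_surj[OF assms] by (metis surjD vec_eq_iff)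
  also have "\<dots> \<longleftrightarrow> (\<forall>i j. E (\<sigma> i) (\<sigma> j) \<longleftrightarrow> E i j)"
    unfolding perm_matrix_mult_nth[OF bij_is_inj[OF assms]] mult_perm_matrix_nth
    by (auto simp: adjacency_matrix_def)
  finally show ?thesis .
qed

theorem proposition1p4:
  fixes E :: "'n::finite \<Rightarrow> 'n \<Rightarrow> bool"
  assumes "simple_graph E"
  shows "perm_matrix ` carrier (aut_group E) = zero_set (aut_ideal E)"
proof -
  have "P \<in> zero_set (aut_ideal E) \<longleftrightarrow>
      P ** adjacency_matrix E = adjacency_matrix E ** P \<and> P \<in> perm_matrix ` {\<sigma>. bij \<sigma>}" for P
    unfolding aut_ideal_def zero_set_genideal zero_set_aut_generators perm_matrix_iff ..
  then show ?thesis
    using perm_matrix_commutes_iff[of _ E] by (auto simp: aut_group_def)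
qed

end
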